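(* Let $K$ be a field, let $n\ge 1$, and let $\phi\colon C_n\to \operatorname{End}_K(V)$ be an irreducible representation of the Chinese monoid $C_n$ over $K$. (1) If $\phi(a_na_1)=0$ then either $\phi(a_n)=0$ or $\phi(a_1)=0$. (2) If $\dim_K V<\infty$, then $\phi(C_n)$ is commutative; hence $\dim_K V=1$ if $K$ is algebraically closed.
   Context: For a positive integer $n$, the Chinese monoid of rank $n$ is the monoid $C_n=\langle a_1,\dots,a_n\rangle$ given by the defining relations $a_ja_ka_i=a_ka_ja_i=a_ka_ia_j$ for all $i\le j\le k$. A representation of $C_n$ over $K$ is a monoid homomorphism $\phi\colon C_n\to\operatorname{End}_K(V)$ for a $K$-linear space $V$; it is irreducible if the corresponding left module $V$ over the monoid algebra $K[C_n]$ is simple. *)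

theory Defs
  imports "HOL-Algebra.Ring" "HOL-Computational_Algebra.Polynomial"
begin

section \<open>Monoid presentations and the Chinese monoid\<close>

text \<open>The least congruence on the free monoid of words over \<open>A\<close> that contains \<open>R\<close>.\<close>

inductive_set word_cong :: "'a set \<Rightarrow> ('a list \<times> 'a list) set \<Rightarrow> ('a list \<times> 'a list) set"
  for A :: "'a set" and R :: "('a list \<times> 'a list) set" where
  base: "(u, v) \<in> R \<Longrightarrow> u \<in> lists A \<Longrightarrow> v \<in> lists A \<Longrightarrow> (u, v) \<in> word_cong A R"
| refl: "u \<in> lists A \<Longrightarrow> (u, u) \<in> word_cong A R"
| sym: "(u, v) \<in> word_cong A R \<Longrightarrow> (v, u) \<in> word_cong A R"
| trans: "(u, v) \<in> word_cong A R \<Longrightarrow> (v, w) \<in> word_cong A R \<Longrightarrow> (u, w) \<in> word_cong A R"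
| append: "(u, v) \<in> word_cong A R \<Longrightarrow> (u', v') \<in> word_cong A R
    \<Longrightarrow> (u @ u', v @ v') \<in> word_cong A R"

definition presented_monoid :: "'a set \<Rightarrow> ('a list \<times> 'a list) set \<Rightarrow> 'a list set monoid" where
  "presented_monoid A R =
    \<lparr>carrier = lists A // word_cong A R,
     monoid.mult = (\<lambda>X Y. word_cong A R `` {x @ y | x y. x \<in> X \<and> y \<in> Y}),
     one = word_cong A R `` {[]}\<rparr>"

lemma word_cong_subset: "word_cong A R \<subseteq> lists A \<times> lists A"
proof (rule subrelI)
  fix u v assume "(u, v) \<in> word_cong A R"
  then show "(u, v) \<in> lists A \<times> lists A"
    by induction auto
qed

lemma equiv_word_cong: "equiv (lists A) (word_cong A R)"
  using word_cong_subset[of A R]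
  by (intro equivI refl_onI symI transI) (auto intro: word_cong.intros)

lemma word_class_mult:
  assumes "u \<in> lists A" and "v \<in> lists A"
  shows "word_cong A R `` {u} \<otimes>\<^bsub>presented_monoid A R\<^esub> word_cong A R `` {v} =
    word_cong A R `` {u @ v}"
proof -
  have "u @ v \<in> {x @ y | x y. (u, x) \<in> word_cong A R \<and> (v, y) \<in> word_cong A R}"
    using assms by (auto intro: word_cong.refl)
  moreover have "(u @ v, w) \<in> word_cong A R"
    if "(u, x) \<in> word_cong A R" "(v, y) \<in> word_cong A R" "(x @ y, w) \<in> word_cong A R" for x y w
    using that by (meson word_cong.append word_cong.trans)
  ultimately show ?thesis
    unfolding presented_monoid_def by (fastforce simp: Image_def)
qed

lemma word_class_in_carrier:
  "u \<in> lists A \<Longrightarrow> word_cong A R `` {u} \<in> carrier (presented_monoid A R)"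
  by (simp add: presented_monoid_def quotientI)

lemma presented_carrierE:
  assumes "X \<in> carrier (presented_monoid A R)"
  obtains u where "u \<in> lists A" and "X = word_cong A R `` {u}"
proof -
  from assms have "X \<in> lists A // word_cong A R" by (simp add: presented_monoid_def)
  then show thesis by (rule quotientE) (rule that)
qed

lemma monoid_presented_monoid: "monoid (presented_monoid A R)"
proof
  have one: "\<one>\<^bsub>presented_monoid A R\<^esub> = word_cong A R `` {[]}"
    by (simp add: presented_monoid_def)
  show "\<one>\<^bsub>presented_monoid A R\<^esub> \<in> carrier (presented_monoid A R)"
    unfolding one by (rule word_class_in_carrier) simp
  fix X assume "X \<in> carrier (presented_monoid A R)"
  then obtain u where u: "u \<in> lists A" "X = word_cong A R `` {u}"
    by (rule presented_carrierE)
  show "\<one>\<^bsub>presented_monoid A R\<^esub> \<otimes>\<^bsub>presented_monoid A R\<^esub> X = X"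
    using u word_class_mult[of "[]" A u R] by (simp add: one)
  show "X \<otimes>\<^bsub>presented_monoid A R\<^esub> \<one>\<^bsub>presented_monoid A R\<^esub> = X"
    using u word_class_mult[of u A "[]" R] by (simp add: one)
  fix Y assume "Y \<in> carrier (presented_monoid A R)"
  then obtain v where v: "v \<in> lists A" "Y = word_cong A R `` {v}"
    by (rule presented_carrierE)
  have uv: "u @ v \<in> lists A" using u v by simp
  show "X \<otimes>\<^bsub>presented_monoid A R\<^esub> Y \<in> carrier (presented_monoid A R)"
    unfolding u v word_class_mult[OF u(1) v(1)] by (rule word_class_in_carrier[OF uv])
  fix Z assume "Z \<in> carrier (presented_monoid A R)"
  then obtain w where w: "w \<in> lists A" "Z = word_cong A R `` {w}"
    by (rule presented_carrierE)
  have vw: "v @ w \<in> lists A" using v w by simp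
  show "X \<otimes>\<^bsub>presented_monoid A R\<^esub> Y \<otimes>\<^bsub>presented_monoid A R\<^esub> Z =
      X \<otimes>\<^bsub>presented_monoid A R\<^esub> (Y \<otimes>\<^bsub>presented_monoid A R\<^esub> Z)"
    unfolding u v w word_class_mult[OF u(1) v(1)] word_class_mult[OF v(1) w(1)]
      word_class_mult[OF uv w(1)] word_class_mult[OF u(1) vw] by simp
qed

text \<open>The letter \<open>i \<in> {1..n}\<close> stands for the generator \<open>a\<^sub>i\<close>.\<close>

definition chinese_relations :: "nat \<Rightarrow> (nat list \<times> nat list) set" where
  "chinese_relations n =
    {([j, k, i], [k, j, i]) | i j k. 1 \<le> i \<and> i \<le> j \<and> j \<le> k \<and> k \<le> n} \<union>
    {([k, j, i], [k, i, j]) | i j k. 1 \<le> i \<and> i \<le> j \<and> j \<le> k \<and> k \<le> n}"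

definition chinese_monoid :: "nat \<Rightarrow> nat list set monoid" where
  "chinese_monoid n = presented_monoid {1..n} (chinese_relations n)"

lemma monoid_chinese_monoid: "monoid (chinese_monoid n)"
  unfolding chinese_monoid_def by (rule monoid_presented_monoid)

definition chinese_gen :: "nat \<Rightarrow> nat \<Rightarrow> nat list set" where
  "chinese_gen n i = word_cong {1..n} (chinese_relations n) `` {[i]}"


section \<open>Left modules over a not necessarily commutative ring\<close>

locale left_module = ring R for R (structure) +
  fixes act :: "'a \<Rightarrow> 'v::ab_group_add \<Rightarrow> 'v"
  assumes act_add_right: "r \<in> carrier R \<Longrightarrow> act r (v + w) = act r v + act r w"
    and act_add_left: "r \<in> carrier R \<Longrightarrow> s \<in> carrier R \<Longrightarrow> act (r \<oplus> s) v = act r v + act s v"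
    and act_mult: "r \<in> carrier R \<Longrightarrow> s \<in> carrier R \<Longrightarrow> act (r \<otimes> s) v = act r (act s v)"
    and act_one: "act \<one> v = v"

definition left_submodule ::
  "('a, 'c) ring_scheme \<Rightarrow> ('a \<Rightarrow> 'v::ab_group_add \<Rightarrow> 'v) \<Rightarrow> 'v set \<Rightarrow> bool" where
  "left_submodule R act W \<longleftrightarrow>
    0 \<in> W \<and> (\<forall>v\<in>W. \<forall>w\<in>W. v + w \<in> W) \<and> (\<forall>r\<in>carrier R. \<forall>v\<in>W. act r v \<in> W)"

definition simple_left_module ::
  "('a, 'c) ring_scheme \<Rightarrow> ('a \<Rightarrow> 'v::ab_group_add \<Rightarrow> 'v) \<Rightarrow> bool" where
  "simple_left_module R act \<longleftrightarrow>
    left_module R act \<and> (UNIV :: 'v set) \<noteq> {0} \<and>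
    (\<forall>W. left_submodule R act W \<longrightarrow> W = {0} \<or> W = UNIV)"


section \<open>Monoid algebras and representations\<close>

text \<open>Elements of the monoid algebra are the finitely supported functions on the carrier of the
  monoid, extended by zero outside of the carrier; \<open>f\<close> stands for the formal sum of all
  \<open>f m \<cdot> m\<close>.\<close>

definition monoid_algebra :: "('m, 'c) monoid_scheme \<Rightarrow> ('m \<Rightarrow> 'k::field) ring" where
  "monoid_algebra M =
    \<lparr>carrier = {f. finite {m. f m \<noteq> 0} \<and> {m. f m \<noteq> 0} \<subseteq> carrier M},
     monoid.mult = (\<lambda>f g x. \<Sum>p | f p \<noteq> 0. \<Sum>q | g q \<noteq> 0. if p \<otimes>\<^bsub>M\<^esub> q = x then f p * g q else 0),
     one = (\<lambda>x. if x = \<one>\<^bsub>M\<^esub> then 1 else 0),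
     zero = (\<lambda>x. 0),
     add = (\<lambda>f g x. f x + g x)\<rparr>"

lemma monoid_algebra_sum:
  fixes f :: "'m \<Rightarrow> 'k::field" and T :: "'m \<Rightarrow> 'k \<Rightarrow> 'w::comm_monoid_add"
  assumes "finite S" and "{m. f m \<noteq> 0} \<subseteq> S" and "\<And>m. T m 0 = 0"
  shows "(\<Sum>m | f m \<noteq> 0. T m (f m)) = (\<Sum>m\<in>S. T m (f m))"
  using assms by (intro sum.mono_neutral_left) auto

lemma monoid_algebra_sum_add:
  fixes f g :: "'m \<Rightarrow> 'k::field" and T :: "'m \<Rightarrow> 'k \<Rightarrow> 'w::comm_monoid_add"
  assumes fin: "finite {m. f m \<noteq> 0}" "finite {m. g m \<noteq> 0}"
    and T0: "\<And>m. T m 0 = 0" and T_add: "\<And>m a b. T m (a + b) = T m a + T m b"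
  shows "(\<Sum>m | f m + g m \<noteq> 0. T m (f m + g m)) =
    (\<Sum>m | f m \<noteq> 0. T m (f m)) + (\<Sum>m | g m \<noteq> 0. T m (g m))"
proof -
  let ?S = "{m. f m \<noteq> 0} \<union> {m. g m \<noteq> 0}"
  have S: "finite ?S" using fin by simp
  have "(\<Sum>m | f m + g m \<noteq> 0. T m (f m + g m)) = (\<Sum>m\<in>?S. T m (f m + g m))"
    by (rule monoid_algebra_sum[OF S]) (auto simp: T0)
  moreover have "(\<Sum>m | f m \<noteq> 0. T m (f m)) = (\<Sum>m\<in>?S. T m (f m))"
    by (rule monoid_algebra_sum[OF S]) (auto simp: T0)
  moreover have "(\<Sum>m | g m \<noteq> 0. T m (g m)) = (\<Sum>m\<in>?S. T m (g m))"
    by (rule monoid_algebra_sum[OF S]) (auto simp: T0)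
  ultimately show ?thesis by (simp add: T_add sum.distrib)
qed

lemma monoid_algebra_sum_one:
  fixes T :: "'m \<Rightarrow> 'k::field \<Rightarrow> 'w::comm_monoid_add"
  shows "(\<Sum>m | \<one>\<^bsub>monoid_algebra M\<^esub> m \<noteq> (0::'k). T m (\<one>\<^bsub>monoid_algebra M\<^esub> m)) = T \<one>\<^bsub>M\<^esub> 1"
  by (simp add: monoid_algebra_def)

lemma monoid_algebra_support_mult:
  fixes f g :: "'m \<Rightarrow> 'k::field"
  shows "{x. (f \<otimes>\<^bsub>monoid_algebra M\<^esub> g) x \<noteq> 0} \<subseteq>
    (\<lambda>(p, q). p \<otimes>\<^bsub>M\<^esub> q) ` ({p. f p \<noteq> 0} \<times> {q. g q \<noteq> 0})"
proof
  fix x assume "x \<in> {x. (f \<otimes>\<^bsub>monoid_algebra M\<^esub> g) x \<noteq> 0}"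
  then have "(\<Sum>p | f p \<noteq> 0. \<Sum>q | g q \<noteq> 0. if p \<otimes>\<^bsub>M\<^esub> q = x then f p * g q else 0) \<noteq> 0"
    by (simp add: monoid_algebra_def)
  then obtain p where p: "p \<in> {p. f p \<noteq> 0}"
    and "(\<Sum>q | g q \<noteq> 0. if p \<otimes>\<^bsub>M\<^esub> q = x then f p * g q else 0) \<noteq> 0"
    by (rule sum.not_neutral_contains_not_neutral)
  from this(2) obtain q where "q \<in> {q. g q \<noteq> 0}"
    and "(if p \<otimes>\<^bsub>M\<^esub> q = x then f p * g q else 0) \<noteq> 0"
    by (rule sum.not_neutral_contains_not_neutral)
  then show "x \<in> (\<lambda>(p, q). p \<otimes>\<^bsub>M\<^esub> q) ` ({p. f p \<noteq> 0} \<times> {q. g q \<noteq> 0})"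
    using p by (force split: if_splits)
qed

lemma monoid_algebra_sum_mult:
  fixes f g :: "'m \<Rightarrow> 'k::field" and T :: "'m \<Rightarrow> 'k \<Rightarrow> 'w::comm_monoid_add"
  assumes fin: "finite {m. f m \<noteq> 0}" "finite {m. g m \<noteq> 0}"
    and T0: "\<And>m. T m 0 = 0" and T_add: "\<And>m a b. T m (a + b) = T m a + T m b"
  shows "(\<Sum>x | (f \<otimes>\<^bsub>monoid_algebra M\<^esub> g) x \<noteq> 0. T x ((f \<otimes>\<^bsub>monoid_algebra M\<^esub> g) x)) =
    (\<Sum>p | f p \<noteq> 0. \<Sum>q | g q \<noteq> 0. T (p \<otimes>\<^bsub>M\<^esub> q) (f p * g q))"
proof -
  let ?S = "(\<lambda>(p, q). p \<otimes>\<^bsub>M\<^esub> q) ` ({p. f p \<noteq> 0} \<times> {q. g q \<noteq> 0})"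
  have S: "finite ?S" using fin by simp
  have T_sum: "T x (sum c I) = (\<Sum>i\<in>I. T x (c i))" for x I and c :: "'m \<Rightarrow> 'k"
    by (induction I rule: infinite_finite_induct) (auto simp: T0 T_add)
  have "(\<Sum>x | (f \<otimes>\<^bsub>monoid_algebra M\<^esub> g) x \<noteq> 0. T x ((f \<otimes>\<^bsub>monoid_algebra M\<^esub> g) x)) =
      (\<Sum>x\<in>?S. T x ((f \<otimes>\<^bsub>monoid_algebra M\<^esub> g) x))"
    by (rule monoid_algebra_sum[where T = T, OF S monoid_algebra_support_mult T0])
  also have "\<dots> = (\<Sum>x\<in>?S. \<Sum>p | f p \<noteq> 0. \<Sum>q | g q \<noteq> 0.
      T x (if p \<otimes>\<^bsub>M\<^esub> q = x then f p * g q else 0))"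
    by (simp add: monoid_algebra_def T_sum)
  also have "\<dots> = (\<Sum>p | f p \<noteq> 0. \<Sum>q | g q \<noteq> 0. \<Sum>x\<in>?S.
      T x (if p \<otimes>\<^bsub>M\<^esub> q = x then f p * g q else 0))"
    by (subst sum.swap, rule sum.cong[OF HOL.refl], rule sum.swap)
  also have "\<dots> = (\<Sum>p | f p \<noteq> 0. \<Sum>q | g q \<noteq> 0. T (p \<otimes>\<^bsub>M\<^esub> q) (f p * g q))"
  proof (intro sum.cong HOL.refl)
    fix p q assume pq: "p \<in> {p. f p \<noteq> 0}" "q \<in> {q. g q \<noteq> 0}"
    have "(\<Sum>x\<in>?S. T x (if p \<otimes>\<^bsub>M\<^esub> q = x then f p * g q else 0)) =
        (\<Sum>x\<in>?S. if p \<otimes>\<^bsub>M\<^esub> q = x then T x (f p * g q) else 0)"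
      by (intro sum.cong HOL.refl) (simp add: T0)
    also have "\<dots> = T (p \<otimes>\<^bsub>M\<^esub> q) (f p * g q)"
      using pq by (subst sum.delta'[OF S]) force
    finally show "(\<Sum>x\<in>?S. T x (if p \<otimes>\<^bsub>M\<^esub> q = x then f p * g q else 0)) =
      T (p \<otimes>\<^bsub>M\<^esub> q) (f p * g q)" .
  qed
  finally show ?thesis .
qed

lemma ring_monoid_algebra:
  assumes "monoid M"
  shows "ring (monoid_algebra M :: ('m \<Rightarrow> 'k::field) ring)"
proof -
  interpret M: monoid M by fact
  let ?A = "monoid_algebra M :: ('m \<Rightarrow> 'k) ring"
  have carrier: "f \<in> carrier ?A \<longleftrightarrow> finite {m. f m \<noteq> 0} \<and> {m. f m \<noteq> 0} \<subseteq> carrier M" for f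
    by (simp add: monoid_algebra_def)
  have mult: "(f \<otimes>\<^bsub>?A\<^esub> g) x =
      (\<Sum>p | f p \<noteq> 0. \<Sum>q | g q \<noteq> 0. if p \<otimes>\<^bsub>M\<^esub> q = x then f p * g q else 0)" for f g x
    by (simp add: monoid_algebra_def)
  have add: "f \<oplus>\<^bsub>?A\<^esub> g = (\<lambda>x. f x + g x)" for f g
    by (simp add: monoid_algebra_def)
  have zero: "\<zero>\<^bsub>?A\<^esub> = (\<lambda>x. 0)"
    by (simp add: monoid_algebra_def)
  have add_closed: "(\<lambda>x. f x + g x) \<in> carrier ?A"
    if "f \<in> carrier ?A" "g \<in> carrier ?A" for f g
  proof -
    have "{x. f x + g x \<noteq> 0} \<subseteq> {x. f x \<noteq> 0} \<union> {x. g x \<noteq> 0}" by auto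
    moreover have "finite ({x. f x \<noteq> 0} \<union> {x. g x \<noteq> 0})"
      using that unfolding carrier by simp
    ultimately show ?thesis
      using that unfolding carrier by (meson Un_subset_iff finite_subset subset_trans)
  qed
  have mult_closed: "f \<otimes>\<^bsub>?A\<^esub> g \<in> carrier ?A"
    if "f \<in> carrier ?A" "g \<in> carrier ?A" for f g
  proof -
    let ?S = "(\<lambda>(p, q). p \<otimes>\<^bsub>M\<^esub> q) ` ({p. f p \<noteq> 0} \<times> {q. g q \<noteq> 0})"
    have "finite ?S" "?S \<subseteq> carrier M" using that unfolding carrier by auto
    then show ?thesis
      using monoid_algebra_support_mult[of M f g] unfolding carrier
      by (meson finite_subset subset_trans)
  qed
  have one_closed: "\<one>\<^bsub>?A\<^esub> \<in> carrier ?A"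
    by (simp add: monoid_algebra_def)
  show ?thesis
  proof (rule ringI)
    show "abelian_group ?A"
    proof (rule abelian_groupI)
      fix f assume f: "f \<in> carrier ?A"
      then have "(\<lambda>x. - f x) \<in> carrier ?A" by (simp add: carrier)
      moreover have "(\<lambda>x. - f x) \<oplus>\<^bsub>?A\<^esub> f = \<zero>\<^bsub>?A\<^esub>" by (simp add: add zero)
      ultimately show "\<exists>g\<in>carrier ?A. g \<oplus>\<^bsub>?A\<^esub> f = \<zero>\<^bsub>?A\<^esub>" by blast
    next
      show "\<zero>\<^bsub>?A\<^esub> \<in> carrier ?A" by (simp add: zero carrier)
    qed (auto simp: add zero algebra_simps intro: add_closed)
    show "monoid ?A"
    proof
      fix f g h assume f: "f \<in> carrier ?A" and g: "g \<in> carrier ?A" and h: "h \<in> carrier ?A"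
      show "f \<otimes>\<^bsub>?A\<^esub> g \<otimes>\<^bsub>?A\<^esub> h = f \<otimes>\<^bsub>?A\<^esub> (g \<otimes>\<^bsub>?A\<^esub> h)"
      proof
        fix x
        have fin: "finite {m. f m \<noteq> 0}" "finite {m. g m \<noteq> 0}" "finite {m. h m \<noteq> 0}"
          using f g h unfolding carrier by auto
        have "(f \<otimes>\<^bsub>?A\<^esub> g \<otimes>\<^bsub>?A\<^esub> h) x = (\<Sum>y | (f \<otimes>\<^bsub>?A\<^esub> g) y \<noteq> 0.
            (\<lambda>y k. \<Sum>r | h r \<noteq> 0. if y \<otimes>\<^bsub>M\<^esub> r = x then k * h r else 0) y ((f \<otimes>\<^bsub>?A\<^esub> g) y))"
          by (subst mult) simp
        also have "\<dots> = (\<Sum>p | f p \<noteq> 0. \<Sum>q | g q \<noteq> 0. \<Sum>r | h r \<noteq> 0.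
            if p \<otimes>\<^bsub>M\<^esub> q \<otimes>\<^bsub>M\<^esub> r = x then f p * g q * h r else 0)"
          by (subst monoid_algebra_sum_mult[OF fin(1,2)])
            (auto simp: distrib_right sum.distrib[symmetric] intro!: sum.cong sum.neutral)
        also have "\<dots> = (\<Sum>p | f p \<noteq> 0. \<Sum>q | g q \<noteq> 0. \<Sum>r | h r \<noteq> 0.
            if p \<otimes>\<^bsub>M\<^esub> (q \<otimes>\<^bsub>M\<^esub> r) = x then f p * (g q * h r) else 0)"
          using f g h unfolding carrier
          by (intro sum.cong HOL.refl) (simp add: M.m_assoc subset_iff mult.assoc)
        also have "\<dots> = (\<Sum>p | f p \<noteq> 0. \<Sum>y | (g \<otimes>\<^bsub>?A\<^esub> h) y \<noteq> 0.
            (\<lambda>y k. if p \<otimes>\<^bsub>M\<^esub> y = x then f p * k else 0) y ((g \<otimes>\<^bsub>?A\<^esub> h) y))"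
          by (intro sum.cong HOL.refl monoid_algebra_sum_mult[OF fin(2,3), symmetric,
                where T = "\<lambda>y k. if p \<otimes>\<^bsub>M\<^esub> y = x then f p * k else 0" for p])
            (auto simp: distrib_left)
        also have "\<dots> = (f \<otimes>\<^bsub>?A\<^esub> (g \<otimes>\<^bsub>?A\<^esub> h)) x"
          by (subst (2) mult) simp
        finally show "(f \<otimes>\<^bsub>?A\<^esub> g \<otimes>\<^bsub>?A\<^esub> h) x = (f \<otimes>\<^bsub>?A\<^esub> (g \<otimes>\<^bsub>?A\<^esub> h)) x" .
      qed
    next
      fix f assume f: "f \<in> carrier ?A"
      have delta: "(\<Sum>q | f q \<noteq> 0. if q = x then f q else 0) = f x" for x
        using f unfolding carrier by (subst sum.delta) auto
      show "\<one>\<^bsub>?A\<^esub> \<otimes>\<^bsub>?A\<^esub> f = f"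
      proof
        fix x
        have "(\<one>\<^bsub>?A\<^esub> \<otimes>\<^bsub>?A\<^esub> f) x =
            (\<Sum>q | f q \<noteq> 0. if \<one>\<^bsub>M\<^esub> \<otimes>\<^bsub>M\<^esub> q = x then 1 * f q else 0)"
          unfolding mult by (rule monoid_algebra_sum_one
            [where T = "\<lambda>p k. \<Sum>q | f q \<noteq> 0. if p \<otimes>\<^bsub>M\<^esub> q = x then k * f q else 0"])
        also have "\<dots> = (\<Sum>q | f q \<noteq> 0. if q = x then f q else 0)"
          using f unfolding carrier by (intro sum.cong HOL.refl) (simp add: subset_iff)
        finally show "(\<one>\<^bsub>?A\<^esub> \<otimes>\<^bsub>?A\<^esub> f) x = f x" by (simp add: delta)
      qed
      show "f \<otimes>\<^bsub>?A\<^esub> \<one>\<^bsub>?A\<^esub> = f"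
      proof
        fix x
        have "(f \<otimes>\<^bsub>?A\<^esub> \<one>\<^bsub>?A\<^esub>) x =
            (\<Sum>p | f p \<noteq> 0. if p \<otimes>\<^bsub>M\<^esub> \<one>\<^bsub>M\<^esub> = x then f p * 1 else 0)"
          unfolding mult by (intro sum.cong HOL.refl) (rule monoid_algebra_sum_one
            [where T = "\<lambda>q k. if p \<otimes>\<^bsub>M\<^esub> q = x then f p * k else 0" for p])
        also have "\<dots> = (\<Sum>p | f p \<noteq> 0. if p = x then f p else 0)"
          using f unfolding carrier by (intro sum.cong HOL.refl) (simp add: subset_iff)
        finally show "(f \<otimes>\<^bsub>?A\<^esub> \<one>\<^bsub>?A\<^esub>) x = f x" by (simp add: delta)
      qed
    qed (auto simp: mult_closed one_closed)
    fix f g h assume f: "f \<in> carrier ?A" and g: "g \<in> carrier ?A" and h: "h \<in> carrier ?A"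
    then have fin: "finite {m. f m \<noteq> 0}" "finite {m. g m \<noteq> 0}" "finite {m. h m \<noteq> 0}"
      unfolding carrier by auto
    show "(f \<oplus>\<^bsub>?A\<^esub> g) \<otimes>\<^bsub>?A\<^esub> h = f \<otimes>\<^bsub>?A\<^esub> h \<oplus>\<^bsub>?A\<^esub> g \<otimes>\<^bsub>?A\<^esub> h"
      unfolding add mult fun_eq_iff
      by (intro allI monoid_algebra_sum_add[OF fin(1,2), where
          T = "\<lambda>p k. \<Sum>r | h r \<noteq> 0. if p \<otimes>\<^bsub>M\<^esub> r = x then k * h r else 0" for x])
        (auto simp: distrib_right sum.distrib[symmetric] intro!: sum.cong sum.neutral)
    show "h \<otimes>\<^bsub>?A\<^esub> (f \<oplus>\<^bsub>?A\<^esub> g) = h \<otimes>\<^bsub>?A\<^esub> f \<oplus>\<^bsub>?A\<^esub> h \<otimes>\<^bsub>?A\<^esub> g"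
      unfolding add mult fun_eq_iff sum.distrib[symmetric]
      by (intro allI sum.cong HOL.refl monoid_algebra_sum_add[OF fin(1,2), where
          T = "\<lambda>q k. if p \<otimes>\<^bsub>M\<^esub> q = x then h p * k else 0" for p x])
        (auto simp: distrib_left)
  qed
qed

definition End_monoid :: "('k::field \<Rightarrow> 'v::ab_group_add \<Rightarrow> 'v) \<Rightarrow> ('v \<Rightarrow> 'v) monoid" where
  "End_monoid scale =
    \<lparr>carrier = {f. Vector_Spaces.linear scale scale f}, monoid.mult = (\<circ>), one = id\<rparr>"

text \<open>\<open>hom\<close> alone does not require preservation of the unit.\<close>

definition monoid_representation ::
  "('m, 'c) monoid_scheme \<Rightarrow> ('k::field \<Rightarrow> 'v::ab_group_add \<Rightarrow> 'v) \<Rightarrow> ('m \<Rightarrow> 'v \<Rightarrow> 'v) \<Rightarrow> bool"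
where
  "monoid_representation M scale \<phi> \<longleftrightarrow>
    \<phi> \<in> hom M (End_monoid scale) \<and> \<phi> \<one>\<^bsub>M\<^esub> = \<one>\<^bsub>End_monoid scale\<^esub>"

definition algebra_action ::
  "('k::field \<Rightarrow> 'v::ab_group_add \<Rightarrow> 'v) \<Rightarrow> ('m \<Rightarrow> 'v \<Rightarrow> 'v) \<Rightarrow> ('m \<Rightarrow> 'k) \<Rightarrow> 'v \<Rightarrow> 'v" where
  "algebra_action scale \<phi> f v = (\<Sum>m | f m \<noteq> 0. scale (f m) (\<phi> m v))"

lemma left_module_algebra_action:
  fixes M :: "('m, 'c) monoid_scheme" and scale :: "'k::field \<Rightarrow> 'v::ab_group_add \<Rightarrow> 'v"
  assumes "monoid M" and vs: "vector_space scale" and rep: "monoid_representation M scale \<phi>"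
  shows "left_module (monoid_algebra M) (algebra_action scale \<phi>)"
proof -
  let ?A = "monoid_algebra M :: ('m \<Rightarrow> 'k) ring"
  interpret ring ?A by (rule ring_monoid_algebra) fact
  interpret vector_space scale by fact
  have lin: "Vector_Spaces.linear scale scale (\<phi> m)" if "m \<in> carrier M" for m
    using rep that by (auto simp: monoid_representation_def End_monoid_def hom_def)
  have mult: "\<phi> (p \<otimes>\<^bsub>M\<^esub> q) v = \<phi> p (\<phi> q v)" if "p \<in> carrier M" "q \<in> carrier M" for p q v
    using rep that by (auto simp: monoid_representation_def End_monoid_def hom_def)
  have one: "\<phi> \<one>\<^bsub>M\<^esub> v = v" for v
    using rep by (simp add: monoid_representation_def End_monoid_def)
  have carrier: "finite {m. f m \<noteq> 0}" "m \<in> carrier M" if "f \<in> carrier ?A" "f m \<noteq> 0" for f m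
    using that by (auto simp: monoid_algebra_def)
  have fin: "finite {m. f m \<noteq> 0}" if "f \<in> carrier ?A" for f
    using that by (auto simp: monoid_algebra_def)
  show ?thesis
  proof
    fix f v w assume f: "f \<in> carrier ?A"
    show "algebra_action scale \<phi> f (v + w) = algebra_action scale \<phi> f v + algebra_action scale \<phi> f w"
      unfolding algebra_action_def sum.distrib[symmetric]
    proof (intro sum.cong HOL.refl)
      fix m assume "m \<in> {m. f m \<noteq> 0}"
      then interpret m: Vector_Spaces.linear scale scale "\<phi> m"
        using carrier(2)[OF f] by (intro lin) simp
      show "scale (f m) (\<phi> m (v + w)) = scale (f m) (\<phi> m v) + scale (f m) (\<phi> m w)"
        by (simp add: m.add scale_right_distrib)
    qed
  next
    fix f g v assume f: "f \<in> carrier ?A" and g: "g \<in> carrier ?A"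
    have add: "f \<oplus>\<^bsub>?A\<^esub> g = (\<lambda>x. f x + g x)" by (simp add: monoid_algebra_def)
    show "algebra_action scale \<phi> (f \<oplus>\<^bsub>?A\<^esub> g) v =
        algebra_action scale \<phi> f v + algebra_action scale \<phi> g v"
      unfolding algebra_action_def add
      by (rule monoid_algebra_sum_add[OF fin[OF f] fin[OF g],
            where T = "\<lambda>m k. scale k (\<phi> m v)"]) (simp_all add: scale_left_distrib)
    have "algebra_action scale \<phi> (f \<otimes>\<^bsub>?A\<^esub> g) v =
        (\<Sum>p | f p \<noteq> 0. \<Sum>q | g q \<noteq> 0. scale (f p * g q) (\<phi> (p \<otimes>\<^bsub>M\<^esub> q) v))"
      unfolding algebra_action_def
      by (rule monoid_algebra_sum_mult[OF fin[OF f] fin[OF g],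
            where T = "\<lambda>m k. scale k (\<phi> m v)"]) (simp_all add: scale_left_distrib)
    also have "\<dots> = (\<Sum>p | f p \<noteq> 0. scale (f p) (\<phi> p (\<Sum>q | g q \<noteq> 0. scale (g q) (\<phi> q v))))"
    proof (intro sum.cong HOL.refl)
      fix p assume "p \<in> {p. f p \<noteq> 0}"
      then have p: "p \<in> carrier M" using carrier(2)[OF f] by simp
      interpret p: Vector_Spaces.linear scale scale "\<phi> p" by (rule lin[OF p])
      show "(\<Sum>q | g q \<noteq> 0. scale (f p * g q) (\<phi> (p \<otimes>\<^bsub>M\<^esub> q) v)) =
          scale (f p) (\<phi> p (\<Sum>q | g q \<noteq> 0. scale (g q) (\<phi> q v)))"
        unfolding p.sum scale_sum_right
        by (intro sum.cong HOL.refl) (simp add: carrier(2)[OF g] p mult p.scale)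
    qed
    finally show "algebra_action scale \<phi> (f \<otimes>\<^bsub>?A\<^esub> g) v =
        algebra_action scale \<phi> f (algebra_action scale \<phi> g v)"
      by (simp add: algebra_action_def)
  next
    fix v
    show "algebra_action scale \<phi> \<one>\<^bsub>?A\<^esub> v = v"
      unfolding algebra_action_def
      by (subst monoid_algebra_sum_one[where T = "\<lambda>m k. scale k (\<phi> m v)"]) (simp add: one)
  qed
qed

definition irreducible_representation ::
  "('m, 'c) monoid_scheme \<Rightarrow> ('k::field \<Rightarrow> 'v::ab_group_add \<Rightarrow> 'v) \<Rightarrow> ('m \<Rightarrow> 'v \<Rightarrow> 'v) \<Rightarrow> bool"
where
  "irreducible_representation M scale \<phi> \<longleftrightarrow>
    monoid_representation M scale \<phi> \<and>
    simple_left_module (monoid_algebra M :: ('m \<Rightarrow> 'k) ring) (algebra_action scale \<phi>)"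

end

theory Submission
  imports Defs
begin

text \<open>
  The argument only uses the operators \<open>a\<^sub>i\<close> by which the generators act on the simple module
  \<open>V\<close>, and the fact that a subspace stable under all of them is trivial.

  For the first part the relations give \<open>a\<^sub>n a\<^sub>i a\<^sub>j = a\<^bsub>max i j\<^esub> a\<^sub>n a\<^bsub>min i j\<^esub>\<close>, so the
  vectors \<open>x\<close> with \<open>a\<^sub>n x = 0\<close> and \<open>a\<^sub>n a\<^sub>i x = 0\<close> for all \<open>i\<close> form a submodule. If
  \<open>a\<^sub>n a\<^sub>1 = 0\<close>, then \<open>a\<^sub>n a\<^sub>i a\<^sub>1 = a\<^sub>n a\<^sub>1 a\<^sub>i = 0\<close> shows that this submodule contains the image
  of \<open>a\<^sub>1\<close>. Hence it is all of \<open>V\<close>, and \<open>a\<^sub>n = 0\<close>, or it is zero, and \<open>a\<^sub>1 = 0\<close>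
  (\<open>product_zero_imp_factor_zero\<close>).

  For commutativity, \<open>a\<^sub>n a\<^sub>1\<close> commutes with every \<open>a\<^sub>i\<close>, so its kernel is a submodule, and
  \<open>a\<^sub>n a\<^sub>1\<close> is zero or injective, as in Schur's lemma. If it is injective and \<open>V\<close> has finite
  dimension, then \<open>a\<^sub>n\<close> is surjective, hence injective, and can be cancelled from
  \<open>a\<^sub>n a\<^sub>j a\<^sub>i = a\<^sub>n a\<^sub>i a\<^sub>j\<close>. If it is zero, then \<open>a\<^sub>n\<close> or \<open>a\<^sub>1\<close> vanishes by the first part, and
  the remaining operators satisfy the same hypotheses on a shorter interval of indices; this is
  the induction in \<open>finite_dimensional_chinese_operators_commute\<close>.

  Over an algebraically closed field each \<open>a\<^sub>i\<close> has an eigenvector. Its eigenspace is stable under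
  the operators commuting with it, so each \<open>a\<^sub>i\<close> is a scalar. Then every line is a submodule,
  and \<open>V\<close> is a line.
\<close>

section \<open>Operators satisfying the Chinese relations\<close>

text \<open>The indices range over an arbitrary interval, since the induction for commutativity
  discards operators at either end.\<close>

locale irreducible_chinese_operators = vector_space scale
  for scale :: "'k::field \<Rightarrow> 'v::ab_group_add \<Rightarrow> 'v" +
  fixes a :: "nat \<Rightarrow> 'v \<Rightarrow> 'v" and l u :: nat
  assumes linear_op: "i \<in> {l..u} \<Longrightarrow> Vector_Spaces.linear scale scale (a i)"
    and rel_left: "\<lbrakk>l \<le> i; i \<le> j; j \<le> k; k \<le> u\<rbrakk> \<Longrightarrow> a j (a k (a i v)) = a k (a j (a i v))"
    and rel_right: "\<lbrakk>l \<le> i; i \<le> j; j \<le> k; k \<le> u\<rbrakk> \<Longrightarrow> a k (a j (a i v)) = a k (a i (a j v))"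
    and irreducible: "\<lbrakk>subspace W; \<And>i w. i \<in> {l..u} \<Longrightarrow> w \<in> W \<Longrightarrow> a i w \<in> W\<rbrakk>
      \<Longrightarrow> W = {0} \<or> W = UNIV"
begin

lemma op_0: "i \<in> {l..u} \<Longrightarrow> a i 0 = 0"
  and op_add: "i \<in> {l..u} \<Longrightarrow> a i (v + w) = a i v + a i w"
  and op_scale: "i \<in> {l..u} \<Longrightarrow> a i (scale c v) = scale c (a i v)"
proof -
  assume i: "i \<in> {l..u}"
  interpret f: Vector_Spaces.linear scale scale "a i" by (rule linear_op[OF i])
  show "a i 0 = 0" "a i (v + w) = a i v + a i w" "a i (scale c v) = scale c (a i v)"
    by (rule f.zero f.add f.scale)+
qed

text \<open>The set \<open>W\<close> below is a submodule on which \<open>a u\<close> vanishes. Its two conditions suffice for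
  stability because moving \<open>a u\<close> past one factor of \<open>a i \<circ> a j\<close> leaves only one operator to its
  right.\<close>

lemma product_zero_imp_factor_zero:
  assumes "l \<le> u" and zero: "\<And>v. a u (a l v) = 0"
  shows "(\<forall>v. a u v = 0) \<or> (\<forall>v. a l v = 0)"
proof -
  define W where "W = {x. a u x = 0 \<and> (\<forall>i\<in>{l..u}. a u (a i x) = 0)}"
  have u: "u \<in> {l..u}" using \<open>l \<le> u\<close> by simp
  have "subspace W"
    unfolding subspace_def W_def using u by (auto simp: op_0 op_add op_scale)
  moreover have "a j x \<in> W" if j: "j \<in> {l..u}" and x: "x \<in> W" for j x
  proof -
    have kill: "a u (a i x) = 0" if "i \<in> {l..u}" for i
      using x that by (simp add: W_def)
    have "a u (a i (a j x)) = 0" if i: "i \<in> {l..u}" for i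
    proof (cases "j \<le> i")
      case True
      then have "a u (a i (a j x)) = a i (a u (a j x))"
        using i j rel_left[of j i u x] by simp
      then show ?thesis using i j by (simp add: kill op_0)
    next
      case False
      then have "a u (a i (a j x)) = a j (a u (a i x))"
        using i j rel_left[of i j u x] rel_right[of i j u x] by simp
      then show ?thesis using i j by (simp add: kill op_0)
    qed
    then show ?thesis using j by (simp add: W_def kill)
  qed
  ultimately have W: "W = {0} \<or> W = UNIV" by (rule irreducible)
  have "a l v \<in> W" for v
  proof -
    have "a u (a i (a l v)) = 0" if "i \<in> {l..u}" for i
      using that rel_right[of l i u v] zero by simp
    then show ?thesis by (simp add: W_def zero)
  qed
  with W show ?thesis by (auto simp: W_def)
qed

lemma extremal_product_central:
  assumes "i \<in> {l..u}"
  shows "a u (a l (a i v)) = a i (a u (a l v))"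
  using assms rel_left[of l i u v] rel_right[of l i u v] by simp

text \<open>One half of Schur's lemma, applied to the central operator \<open>a u \<circ> a l\<close>.\<close>

lemma extremal_product_zero_or_injective:
  assumes "l \<le> u"
  shows "(\<forall>v. a u (a l v) = 0) \<or> (\<forall>v. a u (a l v) = 0 \<longrightarrow> v = 0)"
proof -
  let ?W = "{v. a u (a l v) = 0}"
  have "subspace ?W"
    unfolding subspace_def using assms by (simp add: op_0 op_add op_scale)
  moreover have "a i v \<in> ?W" if "i \<in> {l..u}" "v \<in> ?W" for i v
    using that by (simp add: extremal_product_central op_0)
  ultimately have "?W = {0} \<or> ?W = UNIV" by (rule irreducible)
  then show ?thesis by auto
qed

text \<open>Every subspace is stable under an operator that is zero, so dropping such operators
  preserves irreducibility.\<close>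

lemma restrict_to_subinterval:
  assumes "l \<le> l'" and "u' \<le> u"
    and zero: "\<And>i v. i \<in> {l..u} - {l'..u'} \<Longrightarrow> a i v = 0"
  shows "irreducible_chinese_operators scale a l' u'"
proof (intro irreducible_chinese_operators.intro irreducible_chinese_operators_axioms.intro
    vector_space_axioms)
  fix W assume W: "subspace W" and "\<And>i w. i \<in> {l'..u'} \<Longrightarrow> w \<in> W \<Longrightarrow> a i w \<in> W"
  then have "a i w \<in> W" if "i \<in> {l..u}" "w \<in> W" for i w
    using that zero[of i w] subspace_0[OF W] by (cases "i \<in> {l'..u'}") auto
  with W show "W = {0} \<or> W = UNIV" by (rule irreducible)
next
  fix i j k v assume "l' \<le> i" "i \<le> j" "j \<le> k" "k \<le> u'"
  then show "a j (a k (a i v)) = a k (a j (a i v))" "a k (a j (a i v)) = a k (a i (a j v))"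
    using assms(1,2) rel_left[of i j k v] rel_right[of i j k v] by auto
qed (use assms(1,2) in \<open>auto intro: linear_op\<close>)

lemma commute_if_top_injective:
  assumes "i \<in> {l..u}" and "j \<in> {l..u}" and inj: "inj (a u)"
  shows "a i (a j v) = a j (a i v)"
  using assms(1,2)
proof (induction i j rule: linorder_wlog)
  case (le i j)
  then have "a u (a j (a i v)) = a u (a i (a j v))" by (intro rel_right) auto
  with inj show ?case by (simp add: inj_eq)
next
  case (sym i j)
  then show ?case by simp
qed

end

text \<open>Induction on the length of the interval: either cancellation of the top operator applies, or
  one of the two extremal operators is zero and can be removed. An interval with one element is
  treated apart, since there the truncated difference \<open>u - l\<close> is already zero and would not
  decrease.\<close>

lemma finite_dimensional_chinese_operators_commute:
  assumes fin: "finite_dimensional_vector_space scale B"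
    and "irreducible_chinese_operators scale a l u"
    and "i \<in> {l..u}" and "j \<in> {l..u}"
  shows "a i (a j v) = a j (a i v)"
  using assms(2-4)
proof (induction "u - l" arbitrary: l u rule: less_induct)
  case less
  interpret finite_dimensional_vector_space scale B by fact
  interpret irreducible_chinese_operators scale a l u by fact
  have lu: "l \<le> u" "l \<in> {l..u}" "u \<in> {l..u}" using less.prems by auto
  show ?case
  proof (cases "l = u")
    case True
    then show ?thesis using less.prems by simp
  next
    case False
    from extremal_product_zero_or_injective[OF lu(1)] show ?thesis
    proof
      assume "\<forall>v. a u (a l v) = 0 \<longrightarrow> v = 0"
      moreover have lin: "Vector_Spaces.linear scale scale (a u \<circ> a l)"
        using linear_op lu by (blast intro: Vector_Spaces.linear_compose)
      ultimately have "inj (a u \<circ> a l)"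
        by (simp add: module_hom.inj_iff_eq_0[OF module_hom_linearI])
      then have "surj (a u \<circ> a l)"
        using lin by (rule linear_inj_imp_surj[rotated])
      then have "surj (a u)" unfolding surj_def comp_apply by blast
      then have "inj (a u)"
        using linear_op[OF lu(3)] by (rule linear_surj_imp_inj[rotated])
      then show ?thesis
        using less.prems by (intro commute_if_top_injective)
    next
      assume "\<forall>v. a u (a l v) = 0"
      then have "(\<forall>v. a u v = 0) \<or> (\<forall>v. a l v = 0)"
        using product_zero_imp_factor_zero[OF lu(1)] by blast
      then show ?thesis
      proof
        assume zero: "\<forall>v. a u v = 0"
        show ?thesis
        proof (cases "i = u \<or> j = u")
          case True
          then show ?thesis using zero less.prems by (auto simp: op_0)
        next
          case False
          then have i: "i \<in> {l..u - 1}" and j: "j \<in> {l..u - 1}"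
            using less.prems by auto
          have "irreducible_chinese_operators scale a l (u - 1)"
          proof (rule restrict_to_subinterval)
            fix i v assume "i \<in> {l..u} - {l..u - 1}"
            then have "i = u" by auto
            with zero show "a i v = 0" by simp
          qed simp_all
          then show ?thesis
            using \<open>l \<noteq> u\<close> lu(1) i j by (intro less.hyps[of "u - 1" l]) simp_all
        qed
      next
        assume zero: "\<forall>v. a l v = 0"
        show ?thesis
        proof (cases "i = l \<or> j = l")
          case True
          then show ?thesis using zero less.prems by (auto simp: op_0)
        next
          case False
          then have i: "i \<in> {Suc l..u}" and j: "j \<in> {Suc l..u}"
            using less.prems by auto
          have "irreducible_chinese_operators scale a (Suc l) u"
          proof (rule restrict_to_subinterval)
            fix i v assume "i \<in> {l..u} - {Suc l..u}"
            then have "i = l" by auto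
            with zero show "a i v = 0" by simp
          qed simp_all
          then show ?thesis
            using \<open>l \<noteq> u\<close> lu(1) i j by (intro less.hyps[of u "Suc l"]) auto
        qed
      qed
    qed
  qed
qed

section \<open>Eigenvectors over algebraically closed fields\<close>

text \<open>The vector \<open>p(T) v\<close>, computed by Horner's scheme: the recursion over the coefficients matches
  induction over polynomials.\<close>

definition poly_apply ::
  "('k::field \<Rightarrow> 'v::ab_group_add \<Rightarrow> 'v) \<Rightarrow> ('v \<Rightarrow> 'v) \<Rightarrow> 'k poly \<Rightarrow> 'v \<Rightarrow> 'v" where
  "poly_apply scale T p v = fold_coeffs (\<lambda>c w. scale c v + T w) p 0"

text \<open>Some nonzero polynomial in \<open>T\<close> annihilates \<open>v\<close>, because the iterates of \<open>T\<close> on \<open>v\<close> cannot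
  all be independent. Take such a \<open>p\<close> of least degree. It has a root \<open>c\<close>; writing
  \<open>p = (X - c) r\<close>, the vector \<open>r(T) v\<close> is nonzero by minimality and is killed by \<open>T - c\<close>.\<close>

lemma linear_endomorphism_has_eigenvector:
  fixes scale :: "'k::field \<Rightarrow> 'v::ab_group_add \<Rightarrow> 'v" and T :: "'v \<Rightarrow> 'v" and v :: 'v
  assumes "finite_dimensional_vector_space scale B"
    and closed: "\<And>p :: 'k poly. degree p > 0 \<Longrightarrow> \<exists>c. poly p c = 0"
    and lin: "Vector_Spaces.linear scale scale T" and "v \<noteq> 0"
  shows "\<exists>c w. w \<noteq> 0 \<and> T w = scale c w"
proof -
  interpret finite_dimensional_vector_space scale B by fact
  interpret T: Vector_Spaces.linear scale scale T by fact
  define P where "P p = poly_apply scale T p v" for p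
  have P_0: "P 0 = 0" by (simp add: P_def poly_apply_def)
  have P_pCons: "P (pCons c p) = scale c v + T (P p)" for c p
    by (cases "p = 0"; cases "c = 0") (simp_all add: P_def poly_apply_def T.zero)
  have P_add: "P (p + q) = P p + P q" for p q
    by (induction p q rule: poly_induct2)
      (simp_all add: P_0 P_pCons T.add scale_left_distrib algebra_simps)
  have P_smult: "P (smult c p) = scale c (P p)" for c p
    by (induction p) (simp_all add: P_0 P_pCons T.scale scale_right_distrib)
  have P_diff: "P (p - q) = P p - P q" for p q
    using P_add[of "p - q" q] by simp
  have P_monom: "P (monom 1 i) = (T ^^ i) v" for i
    by (induction i) (simp_all add: monom_0 monom_Suc P_0 P_pCons T.zero)
  let ?f = "\<lambda>i. (T ^^ i) v"
  have "\<exists>d. ?f d \<in> span (?f ` {..<d})"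
  proof (rule ccontr)
    assume none: "\<nexists>d. ?f d \<in> span (?f ` {..<d})"
    have "independent (?f ` {..<d}) \<and> card (?f ` {..<d}) = d" for d
    proof (induction d)
      case (Suc d)
      have "?f d \<notin> span (?f ` {..<d})" using none by blast
      moreover from this have "?f d \<notin> ?f ` {..<d}" by (rule contrapos_nn) (rule span_base)
      ultimately show ?case
        using Suc by (simp add: lessThan_Suc independent_insert)
    qed (simp add: independent_empty)
    then have "Suc (card B) \<le> card B"
      using independent_span_bound[OF finite_Basis, of "?f ` {..<Suc (card B)}"] span_Basis
      by (metis subset_UNIV)
    then show False by simp
  qed
  then obtain d where d: "?f d \<in> span (?f ` {..<d})" by blast
  \<comment> \<open>The values at \<open>v\<close> of the polynomials of degree less than \<open>d\<close>; bounding the degree makes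
    the annihilating polynomial \<open>p0\<close> below monic, hence nonzero.\<close>
  let ?L = "P ` {q. \<forall>i\<ge>d. coeff q i = 0}"
  have "subspace ?L"
  proof (rule subspaceI)
    show "0 \<in> ?L" using P_0 by (intro image_eqI[of _ _ 0]) auto
  next
    fix x y assume "x \<in> ?L" "y \<in> ?L"
    then obtain p q where "x = P p" "y = P q" "\<forall>i\<ge>d. coeff p i = 0" "\<forall>i\<ge>d. coeff q i = 0"
      by blast
    then show "x + y \<in> ?L" by (intro image_eqI[of _ _ "p + q"]) (auto simp: P_add)
  next
    fix c x assume "x \<in> ?L"
    then obtain p where "x = P p" "\<forall>i\<ge>d. coeff p i = 0" by blast
    then show "scale c x \<in> ?L" by (intro image_eqI[of _ _ "smult c p"]) (auto simp: P_smult)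
  qed
  moreover have "?f ` {..<d} \<subseteq> ?L"
    by (force simp: P_monom[symmetric])
  ultimately have "?f d \<in> ?L"
    using d span_minimal by blast
  then obtain q where q: "?f d = P q" "\<forall>i\<ge>d. coeff q i = 0" by blast
  define p0 where "p0 = monom 1 d - q"
  have "coeff p0 d = 1" using q(2) by (simp add: p0_def)
  then have "p0 \<noteq> 0 \<and> P p0 = 0"
    using q(1) by (auto simp: p0_def P_diff P_monom)
  then obtain p where p: "p \<noteq> 0" "P p = 0"
    and least: "\<And>q. q \<noteq> 0 \<Longrightarrow> P q = 0 \<Longrightarrow> degree p \<le> degree q"
    using ex_has_least_nat[of "\<lambda>p. p \<noteq> 0 \<and> P p = 0" p0 degree] by blast
  have "degree p > 0"
  proof (rule ccontr)
    assume "\<not> degree p > 0"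
    then obtain c where "p = [:c:]" by (auto elim: degree_eq_zeroE)
    with p \<open>v \<noteq> 0\<close> show False by (simp add: P_pCons P_0 T.zero)
  qed
  then obtain c where "poly p c = 0" using closed by blast
  then obtain r where r: "p = [:- c, 1:] * r" by (auto simp: poly_eq_0_iff_dvd)
  then have "r \<noteq> 0" using p by auto
  then have "degree r < degree p" using degree_mult_eq[of "[:- c, 1:]" r] by (simp only: r) simp
  then have "P r \<noteq> 0" using least \<open>r \<noteq> 0\<close> by fastforce
  moreover have "[:- c, 1:] * r = pCons 0 r - smult c r" by simp
  then have "T (P r) = scale c (P r)"
    using p(2) unfolding r by (simp only: P_diff P_pCons P_smult) simp
  ultimately show ?thesis by blast
qed

lemma (in irreducible_chinese_operators) commuting_imp_dim_1:
  assumes fin: "finite_dimensional_vector_space scale B"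
    and closed: "\<And>p :: 'k poly. degree p > 0 \<Longrightarrow> \<exists>c. poly p c = 0"
    and commute: "\<And>i j v. i \<in> {l..u} \<Longrightarrow> j \<in> {l..u} \<Longrightarrow> a i (a j v) = a j (a i v)"
    and nontrivial: "(UNIV :: 'v set) \<noteq> {0}"
  shows "dim UNIV = 1"
proof -
  interpret finite_dimensional_vector_space scale B by fact
  obtain v :: 'v where v: "v \<noteq> 0" using nontrivial by blast
  have scalar: "\<exists>c. \<forall>w. a i w = scale c w" if i: "i \<in> {l..u}" for i
  proof -
    obtain c w where w: "w \<noteq> 0" "a i w = scale c w"
      using linear_endomorphism_has_eigenvector[OF fin closed linear_op[OF i] v] by blast
    let ?E = "{w. a i w = scale c w}"
    have "subspace ?E"
      using i by (auto simp: subspace_def op_0 op_add op_scale scale_right_distrib mult.commute)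
    moreover have "a j x \<in> ?E" if "j \<in> {l..u}" "x \<in> ?E" for j x
      using that i by (simp add: commute[of i j] op_scale)
    ultimately have "?E = {0} \<or> ?E = UNIV" by (rule irreducible)
    with w show ?thesis by auto
  qed
  have "a i w \<in> span {v}" if "i \<in> {l..u}" "w \<in> span {v}" for i w
    using scalar[OF that(1)] that(2) by (metis span_scale)
  with subspace_span have "span {v} = {0} \<or> span {v} = UNIV" by (rule irreducible)
  then have "span {v} = UNIV" using v span_base[of v "{v}"] by auto
  then show ?thesis
    using v dim_span[of "{v}"] by (simp del: dim_span)
qed

section \<open>Representations of the Chinese monoid\<close>

lemma chinese_gen_in_carrier:
  "i \<in> {1..n} \<Longrightarrow> chinese_gen n i \<in> carrier (chinese_monoid n)"
  unfolding chinese_gen_def chinese_monoid_def by (rule word_class_in_carrier) simp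

text \<open>Induction over words, transported to the classes that they represent.\<close>

lemma chinese_carrier_induct [consumes 1, case_names one gen]:
  assumes "x \<in> carrier (chinese_monoid n)"
    and one: "P \<one>\<^bsub>chinese_monoid n\<^esub>"
    and gen: "\<And>i x. i \<in> {1..n} \<Longrightarrow> x \<in> carrier (chinese_monoid n) \<Longrightarrow> P x
      \<Longrightarrow> P (chinese_gen n i \<otimes>\<^bsub>chinese_monoid n\<^esub> x)"
  shows "P x"
proof -
  let ?cls = "\<lambda>w. word_cong {1..n} (chinese_relations n) `` {w}"
  obtain w where w: "w \<in> lists {1..n}" "x = ?cls w"
    using assms(1) unfolding chinese_monoid_def by (rule presented_carrierE)
  have "P (?cls w)"
    using w(1)
  proof (induction w)
    case Nil
    then show ?case using one by (simp add: chinese_monoid_def presented_monoid_def)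
  next
    case (Cons i w)
    have "chinese_gen n i \<otimes>\<^bsub>chinese_monoid n\<^esub> ?cls w = ?cls (i # w)"
      using Cons.hyps word_class_mult[of "[i]" "{1..n}" w "chinese_relations n"]
      by (simp add: chinese_gen_def chinese_monoid_def)
    moreover have "?cls w \<in> carrier (chinese_monoid n)"
      unfolding chinese_monoid_def using Cons.hyps by (intro word_class_in_carrier) simp
    ultimately show ?case
      using gen[of i "?cls w"] Cons by simp
  qed
  with w show ?thesis by simp
qed

lemma chinese_gen_mult3:
  assumes "i \<in> {1..n}" "j \<in> {1..n}" "k \<in> {1..n}"
  shows "chinese_gen n i \<otimes>\<^bsub>chinese_monoid n\<^esub> (chinese_gen n j \<otimes>\<^bsub>chinese_monoid n\<^esub> chinese_gen n k) =
    word_cong {1..n} (chinese_relations n) `` {[i, j, k]}"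
  using assms word_class_mult[of "[j]" "{1..n}" "[k]" "chinese_relations n"]
    word_class_mult[of "[i]" "{1..n}" "[j, k]" "chinese_relations n"]
  by (simp add: chinese_gen_def chinese_monoid_def)

lemma chinese_gen_relations:
  assumes "1 \<le> i" "i \<le> j" "j \<le> k" "k \<le> n"
  defines "g \<equiv> chinese_gen n" and "M \<equiv> chinese_monoid n"
  shows "g j \<otimes>\<^bsub>M\<^esub> (g k \<otimes>\<^bsub>M\<^esub> g i) = g k \<otimes>\<^bsub>M\<^esub> (g j \<otimes>\<^bsub>M\<^esub> g i)"
    and "g k \<otimes>\<^bsub>M\<^esub> (g j \<otimes>\<^bsub>M\<^esub> g i) = g k \<otimes>\<^bsub>M\<^esub> (g i \<otimes>\<^bsub>M\<^esub> g j)"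
proof -
  have ijk: "i \<in> {1..n}" "j \<in> {1..n}" "k \<in> {1..n}" using assms(1-4) by auto
  have "([j, k, i], [k, j, i]) \<in> word_cong {1..n} (chinese_relations n)"
    "([k, j, i], [k, i, j]) \<in> word_cong {1..n} (chinese_relations n)"
    using assms(1-4) ijk by (auto intro!: word_cong.base simp: chinese_relations_def)
  then show "g j \<otimes>\<^bsub>M\<^esub> (g k \<otimes>\<^bsub>M\<^esub> g i) = g k \<otimes>\<^bsub>M\<^esub> (g j \<otimes>\<^bsub>M\<^esub> g i)"
    "g k \<otimes>\<^bsub>M\<^esub> (g j \<otimes>\<^bsub>M\<^esub> g i) = g k \<otimes>\<^bsub>M\<^esub> (g i \<otimes>\<^bsub>M\<^esub> g j)"
    unfolding g_def M_def using ijk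
    by (simp_all add: chinese_gen_mult3 equiv_class_eq[OF equiv_word_cong])
qed

text \<open>A subspace stable under the generators is stable under all monoid elements, hence under
  their linear combinations, so it is a submodule over the monoid algebra.\<close>

lemma irreducible_chinese_operators_of_representation:
  assumes vs: "vector_space scale"
    and irr: "irreducible_representation (chinese_monoid n) scale \<phi>"
  shows "irreducible_chinese_operators scale (\<lambda>i. \<phi> (chinese_gen n i)) 1 n"
proof -
  let ?M = "chinese_monoid n" and ?g = "chinese_gen n"
  interpret vector_space scale by fact
  interpret M: monoid ?M by (rule monoid_chinese_monoid)
  have rep: "monoid_representation ?M scale \<phi>"
    using irr by (simp add: irreducible_representation_def)
  have lin: "Vector_Spaces.linear scale scale (\<phi> x)" if "x \<in> carrier ?M" for x
    using rep that by (auto simp: monoid_representation_def End_monoid_def hom_def)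
  have mult: "\<phi> (x \<otimes>\<^bsub>?M\<^esub> y) v = \<phi> x (\<phi> y v)" if "x \<in> carrier ?M" "y \<in> carrier ?M" for x y v
    using rep that by (auto simp: monoid_representation_def End_monoid_def hom_def)
  have one: "\<phi> \<one>\<^bsub>?M\<^esub> v = v" for v
    using rep by (simp add: monoid_representation_def End_monoid_def)
  have mult3: "\<phi> (?g i) (\<phi> (?g j) (\<phi> (?g k) v)) = \<phi> (?g i \<otimes>\<^bsub>?M\<^esub> (?g j \<otimes>\<^bsub>?M\<^esub> ?g k)) v"
    if "i \<in> {1..n}" "j \<in> {1..n}" "k \<in> {1..n}" for i j k v
    using that by (simp add: mult chinese_gen_in_carrier)
  show ?thesis
  proof (intro irreducible_chinese_operators.intro irreducible_chinese_operators_axioms.intro vs)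
    fix i j k v assume ijk: "1 \<le> i" "i \<le> j" "j \<le> k" "k \<le> n"
    then have mem: "i \<in> {1..n}" "j \<in> {1..n}" "k \<in> {1..n}" by auto
    show "\<phi> (?g j) (\<phi> (?g k) (\<phi> (?g i) v)) = \<phi> (?g k) (\<phi> (?g j) (\<phi> (?g i) v))"
      "\<phi> (?g k) (\<phi> (?g j) (\<phi> (?g i) v)) = \<phi> (?g k) (\<phi> (?g i) (\<phi> (?g j) v))"
      by (simp_all only: mult3 mem chinese_gen_relations[OF ijk])
  next
    fix W assume W: "subspace W"
      and inv: "\<And>i w. i \<in> {1..n} \<Longrightarrow> w \<in> W \<Longrightarrow> \<phi> (?g i) w \<in> W"
    have stable: "\<phi> x w \<in> W" if "x \<in> carrier ?M" "w \<in> W" for x w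
      using that
      by (induction rule: chinese_carrier_induct)
        (simp_all add: one mult chinese_gen_in_carrier inv)
    have "left_submodule (monoid_algebra ?M :: (_ \<Rightarrow> 'a) ring) (algebra_action scale \<phi>) W"
      unfolding left_submodule_def
    proof (intro conjI ballI)
      fix f :: "_ \<Rightarrow> 'a" and w
      assume "f \<in> carrier (monoid_algebra ?M)" "w \<in> W"
      then show "algebra_action scale \<phi> f w \<in> W"
        unfolding algebra_action_def
        by (intro subspace_sum[OF W] subspace_scale[OF W] stable) (auto simp: monoid_algebra_def)
    qed (auto intro: subspace_0[OF W] subspace_add[OF W])
    then show "W = {0} \<or> W = UNIV"
      using irr by (simp add: irreducible_representation_def simple_left_module_def)
  qed (rule lin, rule chinese_gen_in_carrier)
qed

lemma representation_commutes_if_generators_commute: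
  assumes rep: "monoid_representation (chinese_monoid n) scale \<phi>"
    and commute: "\<And>i j v. i \<in> {1..n} \<Longrightarrow> j \<in> {1..n} \<Longrightarrow>
      \<phi> (chinese_gen n i) (\<phi> (chinese_gen n j) v) = \<phi> (chinese_gen n j) (\<phi> (chinese_gen n i) v)"
    and x: "x \<in> carrier (chinese_monoid n)" and y: "y \<in> carrier (chinese_monoid n)"
  shows "\<phi> x (\<phi> y v) = \<phi> y (\<phi> x v)"
proof -
  let ?M = "chinese_monoid n" and ?g = "chinese_gen n"
  have mult: "\<phi> (x \<otimes>\<^bsub>?M\<^esub> y) v = \<phi> x (\<phi> y v)" if "x \<in> carrier ?M" "y \<in> carrier ?M" for x y v
    using rep that by (auto simp: monoid_representation_def End_monoid_def hom_def)
  have one: "\<phi> \<one>\<^bsub>?M\<^esub> v = v" for v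
    using rep by (simp add: monoid_representation_def End_monoid_def)
  have gen: "\<phi> (?g i) (\<phi> y v) = \<phi> y (\<phi> (?g i) v)" if i: "i \<in> {1..n}" for i v
    using y
    by (induction arbitrary: v rule: chinese_carrier_induct)
      (simp_all add: one mult chinese_gen_in_carrier commute[OF i] del: atLeastAtMost_iff)
  show ?thesis
    using x
    by (induction arbitrary: v rule: chinese_carrier_induct)
      (simp_all add: one mult chinese_gen_in_carrier gen)
qed

theorem proposition3p1:
  fixes n :: nat
    and scale :: "'k::field \<Rightarrow> 'v::ab_group_add \<Rightarrow> 'v"
    and \<phi> :: "nat list set \<Rightarrow> 'v \<Rightarrow> 'v"
  assumes "n \<ge> 1"
    and "vector_space scale"
    and "irreducible_representation (chinese_monoid n) scale \<phi>"
  shows "(\<phi> (chinese_gen n n \<otimes>\<^bsub>chinese_monoid n\<^esub> chinese_gen n 1) = (\<lambda>v. 0) \<longrightarrow>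
      \<phi> (chinese_gen n n) = (\<lambda>v. 0) \<or> \<phi> (chinese_gen n 1) = (\<lambda>v. 0)) \<and>
      ((\<exists>B. finite_dimensional_vector_space scale B) \<longrightarrow>
      (\<forall>x\<in>carrier (chinese_monoid n). \<forall>y\<in>carrier (chinese_monoid n).
        \<phi> x \<circ> \<phi> y = \<phi> y \<circ> \<phi> x) \<and>
      ((\<forall>p :: 'k poly. degree p > 0 \<longrightarrow> (\<exists>c. poly p c = 0)) \<longrightarrow>
        vector_space.dim scale (UNIV :: 'v set) = 1))"
proof -
  let ?a = "\<lambda>i. \<phi> (chinese_gen n i)"
  interpret irreducible_chinese_operators scale ?a 1 n
    using assms(2,3) by (rule irreducible_chinese_operators_of_representation)
  have rep: "monoid_representation (chinese_monoid n) scale \<phi>"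
    and nontrivial: "(UNIV :: 'v set) \<noteq> {0}"
    using assms(3) by (auto simp: irreducible_representation_def simple_left_module_def)
  have "?a n = (\<lambda>v. 0) \<or> ?a 1 = (\<lambda>v. 0)"
    if "\<phi> (chinese_gen n n \<otimes>\<^bsub>chinese_monoid n\<^esub> chinese_gen n 1) = (\<lambda>v. 0)"
  proof -
    have "\<phi> (chinese_gen n n \<otimes>\<^bsub>chinese_monoid n\<^esub> chinese_gen n 1) = ?a n \<circ> ?a 1"
      using rep chinese_gen_in_carrier[of n n] chinese_gen_in_carrier[of 1 n] \<open>n \<ge> 1\<close>
      by (auto simp: monoid_representation_def End_monoid_def hom_def)
    then have "?a n (?a 1 v) = 0" for v using that by (simp add: fun_eq_iff)
    with product_zero_imp_factor_zero[OF \<open>n \<ge> 1\<close>] show ?thesis by blast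
  qed
  moreover have "(\<forall>x\<in>carrier (chinese_monoid n). \<forall>y\<in>carrier (chinese_monoid n).
      \<phi> x \<circ> \<phi> y = \<phi> y \<circ> \<phi> x) \<and>
      ((\<forall>p :: 'k poly. degree p > 0 \<longrightarrow> (\<exists>c. poly p c = 0)) \<longrightarrow> dim UNIV = 1)"
    if fin: "finite_dimensional_vector_space scale B" for B
  proof -
    have commute: "?a i (?a j v) = ?a j (?a i v)" if "i \<in> {1..n}" "j \<in> {1..n}" for i j v
      using fin irreducible_chinese_operators_axioms that
      by (rule finite_dimensional_chinese_operators_commute)
    have "\<phi> x \<circ> \<phi> y = \<phi> y \<circ> \<phi> x"
      if "x \<in> carrier (chinese_monoid n)" "y \<in> carrier (chinese_monoid n)" for x y
      using representation_commutes_if_generators_commute[OF rep commute that]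
      by (simp add: fun_eq_iff)
    moreover have "dim UNIV = 1" if "\<forall>p :: 'k poly. degree p > 0 \<longrightarrow> (\<exists>c. poly p c = 0)"
      using fin _ commute nontrivial by (rule commuting_imp_dim_1) (use that in blast)
    ultimately show ?thesis by blast
  qed
  ultimately show ?thesis by blast
qed

end
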